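(* For a graph $G$ of size $n$ (that is, with $n$ vertices) and core number $K(G)$, one can decompose the maximum clique problem in $G$ into at most $n-K(G)+1$ subproblems, each of which is upper-bounded in size by $K(G)$.
   Context: Graphs $G=(V,E)$ are finite, undirected and nonempty; two distinct vertices $u,v$ are adjacent if $\{u,v\}\in E$. For $U\subseteq V$, $G[U]$ denotes the subgraph of $G$ induced by $U$. A clique of $G$ is a subgraph in which every pair of vertices is adjacent, and the maximum clique problem in $G$ is to find a clique of $G$ of largest size. The core number $K(v)$ of a vertex $v$ is the largest integer $k\ge 0$ such that $v$ belongs to an induced subgraph of $G$ in which every vertex has degree at least $k$. The core number of the graph is $K(G)=\max_{v\in V}K(v)$. "Decompose" is used informally: the original problem is broken into smaller problems whose solutions are combined to solve it. Here a subproblem is a maximum clique problem on an induced subgraph $G[S]$, and its size is $|S|$. In the decomposition intended, the vertices are put in a degeneracy ordering (non-decreasing in core number, obtained by repeatedly removing a vertex of minimum current core value). One subproblem is the subgraph induced by the last $K(G)$ vertices in this ordering. Each remaining vertex $w$ serves as a root vertex and gives the subproblem induced by the neighbours of $w$ that come after $w$ in the ordering. *)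

theory Defs
  imports "HOL-Library.Ramsey"
begin

text \<open>
  A graph is a vertex set \<open>V\<close> with a set \<open>E\<close> of two-element subsets of \<open>V\<close>.
  Cliques are identified with their vertex sets, so \<^const>\<open>clique\<close> from the Ramsey
  theory applies. The graph induced by \<open>U\<close> has vertex set \<open>U\<close> and edge set
  \<open>induced_edges E U\<close>.
\<close>

definition simple_graph :: "'a set \<Rightarrow> 'a set set \<Rightarrow> bool" where
  "simple_graph V E \<longleftrightarrow> finite V \<and> V \<noteq> {} \<and> E \<subseteq> nsets V 2"

definition induced_edges :: "'a set set \<Rightarrow> 'a set \<Rightarrow> 'a set set" where
  "induced_edges E U = {e \<in> E. e \<subseteq> U}"

definition vertex_degree :: "'a set set \<Rightarrow> 'a \<Rightarrow> nat" where
  "vertex_degree E v = card {u. {u, v} \<in> E}"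

definition maximum_clique :: "'a set \<Rightarrow> 'a set set \<Rightarrow> 'a set \<Rightarrow> bool" where
  "maximum_clique V E C \<longleftrightarrow>
     C \<subseteq> V \<and> clique C E \<and> (\<forall>D. D \<subseteq> V \<and> clique D E \<longrightarrow> card D \<le> card C)"

definition core_number :: "'a set \<Rightarrow> 'a set set \<Rightarrow> 'a \<Rightarrow> nat" where
  "core_number V E v =
     Max {k. \<exists>U. U \<subseteq> V \<and> v \<in> U \<and> (\<forall>u\<in>U. k \<le> vertex_degree (induced_edges E U) u)}"

definition graph_core_number :: "'a set \<Rightarrow> 'a set set \<Rightarrow> nat" where
  "graph_core_number V E = Max (core_number V E ` V)"

text \<open>
  \<open>current_core_value E vs i u\<close> is the tentative core number of \<open>u\<close> in the peeling
  algorithm once the first \<open>i\<close> vertices of \<open>vs\<close> have been removed: it starts as the degree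
  of \<open>u\<close> and decreases by one with each removed neighbour, but never below the value
  of a vertex that has already been removed. So it is the larger of the degree of \<open>u\<close> among the
  remaining vertices and the largest degree that a removed vertex had when it was removed.
  In particular, always removing a vertex of minimum remaining degree removes a vertex of
  minimum current core value. (Reading the current core value as the core number in
  the remaining graph would not do: in a star one could then remove the centre first.)
\<close>

definition current_core_value :: "'a set set \<Rightarrow> 'a list \<Rightarrow> nat \<Rightarrow> 'a \<Rightarrow> nat" where
  "current_core_value E vs i u =
     Max (insert (vertex_degree (induced_edges E (set (drop i vs))) u)
           ((\<lambda>j. vertex_degree (induced_edges E (set (drop j vs))) (vs ! j)) ` {..<i}))"

definition degeneracy_ordering :: "'a set \<Rightarrow> 'a set set \<Rightarrow> 'a list \<Rightarrow> bool" where
  "degeneracy_ordering V E vs \<longleftrightarrow>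
     distinct vs \<and> set vs = V \<and> sorted (map (core_number V E) vs) \<and>
     (\<forall>i < length vs. \<forall>u \<in> set (drop i vs).
        current_core_value E vs i (vs ! i) \<le> current_core_value E vs i u)"

definition later_neighbours :: "'a set set \<Rightarrow> 'a list \<Rightarrow> nat \<Rightarrow> 'a set" where
  "later_neighbours E vs i = {u \<in> set (drop (Suc i) vs). {u, vs ! i} \<in> E}"

text \<open>
  A subproblem \<open>(r, S)\<close> is the maximum clique problem in the graph induced by \<open>S\<close>,
  tagged with its root vertex, if any. The tag keeps subproblems of different roots apart
  when they are counted, even if their vertex sets coincide. The difference
  \<open>card V - graph_core_number V E\<close> is not truncated, as the core number of a
  nonempty graph is less than its number of vertices.
\<close>

definition subproblems ::
    "'a set \<Rightarrow> 'a set set \<Rightarrow> 'a list \<Rightarrow> ('a option \<times> 'a set) set" where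
  "subproblems V E vs =
     insert (None, set (drop (card V - graph_core_number V E) vs))
       ((\<lambda>i. (Some (vs ! i), later_neighbours E vs i)) ` {..<card V - graph_core_number V E})"

text \<open>
  The subproblems solve the maximum clique problem if, for every choice of a
  solution to each of them, adding to each solution its root and taking any largest
  resulting set gives a maximum clique of the whole graph.
\<close>

definition decomposes_maximum_clique ::
    "'a set \<Rightarrow> 'a set set \<Rightarrow> ('a option \<times> 'a set) set \<Rightarrow> bool" where
  "decomposes_maximum_clique V E P \<longleftrightarrow>
     finite P \<and> P \<noteq> {} \<and> (\<forall>(r, S) \<in> P. set_option r \<subseteq> V \<and> S \<subseteq> V) \<and>
     (\<forall>sol. (\<forall>(r, S) \<in> P. maximum_clique S (induced_edges E S) (sol (r, S))) \<longrightarrow>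
        (let candidates = (\<lambda>(r, S). set_option r \<union> sol (r, S)) ` P in
         \<forall>C \<in> candidates. (\<forall>D \<in> candidates. card D \<le> card C) \<longrightarrow> maximum_clique V E C))"

end

theory Submission
  imports Defs
begin

text \<open>
  Let \<open>d\<^sub>i\<close> be the degree of the \<open>i\<close>-th vertex of an ordering in the graph induced by it and
  the later vertices. If a vertex of minimum remaining degree is removed at each step, then the core
  number of the \<open>i\<close>-th vertex is the maximum of the \<open>d\<^sub>j\<close> with \<open>j \<le> i\<close>: the remaining vertices at
  step \<open>j\<close> induce a graph of minimum degree \<open>d\<^sub>j\<close>, and, conversely, if \<open>j\<close> is the first
  vertex of an induced subgraph, then the minimum degree of that subgraph is at most \<open>d\<^sub>j\<close>. So the
  core numbers are sorted along the ordering.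

  In any degeneracy ordering, a \<open>d\<^sub>i\<close> that exceeds all earlier ones is the minimum
  degree of the remaining graph, hence all \<open>d\<^sub>i\<close> are bounded by the core number of the graph. A
  clique is either contained in the last vertices or consists of its first vertex, a root, and
  a clique among the later neighbours of that root.
\<close>

section \<open>List suffixes, cliques and the number of subproblems\<close>

lemma nth_mem_set_drop:
  assumes "j \<le> i" "i < length vs"
  shows "vs ! i \<in> set (drop j vs)"
  using assms by (auto simp: in_set_conv_nth intro: exI[of _ "i - j"])

text \<open>Serves twice: for a vertex set that witnesses a core number, and for a clique that needs
  a root. The index \<open>j\<close> is the least position at which the list meets
  \<open>U\<close>.\<close>

lemma first_index_in_subset:
  assumes "U \<subseteq> set vs" "U \<noteq> {}"
  obtains j where "j < length vs" "vs ! j \<in> U" "U \<subseteq> set (drop j vs)"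
    "\<And>l. l < length vs \<Longrightarrow> vs ! l \<in> U \<Longrightarrow> j \<le> l"
proof -
  let ?P = "\<lambda>j. j < length vs \<and> vs ! j \<in> U"
  define j where "j = (LEAST j. ?P j)"
  have "\<exists>j. ?P j"
    using assms by (metis in_set_conv_nth subset_eq ex_in_conv)
  then have j: "?P j"
    unfolding j_def by (rule LeastI_ex)
  have least: "j \<le> l" if "l < length vs" "vs ! l \<in> U" for l
    unfolding j_def using that by (intro Least_le) simp
  have "u \<in> set (drop j vs)" if u: "u \<in> U" for u
  proof -
    from u assms(1) obtain l where l: "l < length vs" "u = vs ! l"
      by (metis in_set_conv_nth subset_eq)
    then have "j \<le> l"
      using least u by blast
    then show ?thesis
      using l nth_mem_set_drop by blast
  qed
  then show thesis
    using that j least by blast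
qed

lemma clique_induced_edges_iff:
  assumes "C \<subseteq> S"
  shows "clique C (induced_edges E S) \<longleftrightarrow> clique C E"
  using assms by (auto simp: clique_def induced_edges_def)

lemma clique_insert_root:
  assumes "clique C E" "\<And>u. u \<in> C \<Longrightarrow> {u, v} \<in> E"
  shows "clique (insert v C) E"
  using assms by (auto simp: clique_def insert_commute)

lemma finite_subproblems: "finite (subproblems V E vs)"
  by (simp add: subproblems_def)

lemma card_subproblems:
  "card (subproblems V E vs) \<le> Suc (card V - graph_core_number V E)"
  unfolding subproblems_def
  using card_image_le[of "{..<card V - graph_core_number V E}"
    "\<lambda>i. (Some (vs ! i), later_neighbours E vs i)"]
  by (simp add: card_insert_if)

section \<open>Degrees in induced subgraphs and core numbers\<close>

context
  fixes V :: "'a set" and E :: "'a set set"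
  assumes graph: "simple_graph V E"
begin

lemma finite_vertices: "finite V" and vertices_nonempty: "V \<noteq> {}"
  using graph by (auto simp: simple_graph_def)

text \<open>A loop at \<open>v\<close> would be \<open>{v, v}\<close>, which collapses to the
  one-element set \<open>{v}\<close>.\<close>

lemma no_loop: "{v} \<notin> E"
  using graph by (auto simp: simple_graph_def nsets_def)

lemma edge_in_vertices: "e \<in> E \<Longrightarrow> e \<subseteq> V"
  using graph by (auto simp: simple_graph_def nsets_def)

lemma induced_degree_mono:
  assumes "U \<subseteq> W" "W \<subseteq> V"
  shows "vertex_degree (induced_edges E U) v \<le> vertex_degree (induced_edges E W) v"
  unfolding vertex_degree_def
proof (rule card_mono)
  show "finite {u. {u, v} \<in> induced_edges E W}"
    by (rule finite_subset[OF _ finite_vertices]) (use assms in \<open>auto simp: induced_edges_def\<close>)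
qed (use assms in \<open>auto simp: induced_edges_def\<close>)

lemma induced_degree_less_card:
  assumes "U \<subseteq> V" "v \<in> U"
  shows "vertex_degree (induced_edges E U) v < card U"
proof -
  have fin: "finite U"
    using assms finite_vertices finite_subset by blast
  have "vertex_degree (induced_edges E U) v \<le> card (U - {v})"
    unfolding vertex_degree_def
    by (rule card_mono) (use fin no_loop in \<open>auto simp: induced_edges_def\<close>)
  also have "\<dots> < card U"
    using fin assms by (meson card_Diff1_less)
  finally show ?thesis .
qed

text \<open>Makes the \<open>Max\<close> in \<open>core_number\<close> meaningful. Since
  \<open>v\<close> lies in \<open>U\<close>, a level \<open>k\<close> is at most the degree of
  \<open>v\<close> in the induced graph, hence below \<open>card U\<close>.\<close>

lemma finite_core_levels:
  "finite {k. \<exists>U. U \<subseteq> V \<and> v \<in> U \<and> (\<forall>u\<in>U. k \<le> vertex_degree (induced_edges E U) u)}"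
proof (rule finite_subset)
  show "{k. \<exists>U. U \<subseteq> V \<and> v \<in> U \<and> (\<forall>u\<in>U. k \<le> vertex_degree (induced_edges E U) u)} \<subseteq> {..card V}"
  proof clarify
    fix k U assume U: "U \<subseteq> V" "v \<in> U" "\<forall>u\<in>U. k \<le> vertex_degree (induced_edges E U) u"
    then have "k < card U"
      using induced_degree_less_card by (meson le_less_trans)
    also have "\<dots> \<le> card V"
      using card_mono[OF finite_vertices U(1)] .
    finally show "k \<le> card V"
      by simp
  qed
qed simp

lemma core_number_ge:
  assumes "U \<subseteq> V" "v \<in> U" "\<And>u. u \<in> U \<Longrightarrow> k \<le> vertex_degree (induced_edges E U) u"
  shows "k \<le> core_number V E v"
  unfolding core_number_def by (rule Max_ge[OF finite_core_levels]) (use assms in blast)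

lemma core_number_attained:
  assumes "v \<in> V"
  obtains U where "U \<subseteq> V" "v \<in> U"
    "\<And>u. u \<in> U \<Longrightarrow> core_number V E v \<le> vertex_degree (induced_edges E U) u"
proof -
  have "core_number V E v \<in>
      {k. \<exists>U. U \<subseteq> V \<and> v \<in> U \<and> (\<forall>u\<in>U. k \<le> vertex_degree (induced_edges E U) u)}"
    unfolding core_number_def
    \<comment> \<open>The set of levels is nonempty because \<open>{v}\<close> is a possible choice
      of \<open>U\<close>.\<close>
    by (rule Max_in[OF finite_core_levels]) (use assms in blast)
  then show thesis
    using that by blast
qed

lemma graph_core_number_ge: "v \<in> V \<Longrightarrow> core_number V E v \<le> graph_core_number V E"
  unfolding graph_core_number_def using finite_vertices by simp

lemma graph_core_number_less_card: "graph_core_number V E < card V"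
proof -
  have "graph_core_number V E \<in> core_number V E ` V"
    unfolding graph_core_number_def using finite_vertices vertices_nonempty by (intro Max_in) auto
  then obtain v where v: "v \<in> V" "graph_core_number V E = core_number V E v"
    by blast
  obtain U where U: "U \<subseteq> V" "v \<in> U"
    "\<And>u. u \<in> U \<Longrightarrow> core_number V E v \<le> vertex_degree (induced_edges E U) u"
    using core_number_attained v(1) by blast
  then have "core_number V E v < card U"
    using induced_degree_less_card by (meson le_less_trans)
  then show ?thesis
    using v(2) card_mono[OF finite_vertices U(1)] by simp
qed

section \<open>Existence of a degeneracy ordering\<close>

lemma min_degree_peeling_exists:
  assumes "U \<subseteq> V"
  shows "\<exists>vs. distinct vs \<and> set vs = U \<and>
    (\<forall>i < length vs. \<forall>u \<in> set (drop i vs).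
      vertex_degree (induced_edges E (set (drop i vs))) (vs ! i)
        \<le> vertex_degree (induced_edges E (set (drop i vs))) u)"
proof -
  have "finite U"
    using assms finite_vertices finite_subset by blast
  then show ?thesis
  proof (induction U rule: finite_psubset_induct)
    case (psubset U)
    show ?case
    proof (cases "U = {}")
      case False
      let ?d = "vertex_degree (induced_edges E U)"
      obtain x where x: "x \<in> U" "\<And>u. u \<in> U \<Longrightarrow> ?d x \<le> ?d u"
        using arg_min_if_finite(1)[of U ?d] arg_min_least[of U _ ?d] psubset.hyps False by blast
      then have "U - {x} \<subset> U"
        by blast
      then obtain vs where vs: "distinct vs" "set vs = U - {x}"
        "\<And>i u. i < length vs \<Longrightarrow> u \<in> set (drop i vs) \<Longrightarrow>
          vertex_degree (induced_edges E (set (drop i vs))) (vs ! i)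
            \<le> vertex_degree (induced_edges E (set (drop i vs))) u"
        using psubset.IH by meson
      have set: "set (x # vs) = U"
        using vs(2) x(1) by auto
      have "vertex_degree (induced_edges E (set (drop i (x # vs)))) ((x # vs) ! i)
          \<le> vertex_degree (induced_edges E (set (drop i (x # vs)))) u"
        if "i < length (x # vs)" "u \<in> set (drop i (x # vs))" for i u
      proof (cases i)
        case 0
        then show ?thesis
          using that(2) x(2)[of u] set by auto
      next
        \<comment> \<open>The suffixes of \<open>x # vs\<close> past its head are the suffixes of
          \<open>vs\<close>, so minimality is inherited from the peeling of
          \<open>U - {x}\<close>.\<close>
        case (Suc k)
        then show ?thesis
          using that vs(3) by simp
      qed
      moreover have "distinct (x # vs)"
        using vs by simp
      ultimately show ?thesis
        using set by blast
    qed auto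
  qed
qed

lemma core_number_min_degree_peeling:
  assumes vs: "set vs = V"
    and min: "\<And>i u. i < length vs \<Longrightarrow> u \<in> set (drop i vs) \<Longrightarrow>
      vertex_degree (induced_edges E (set (drop i vs))) (vs ! i)
        \<le> vertex_degree (induced_edges E (set (drop i vs))) u"
    and i: "i < length vs"
  shows "core_number V E (vs ! i) =
    Max ((\<lambda>j. vertex_degree (induced_edges E (set (drop j vs))) (vs ! j)) ` {..i})"
proof (rule antisym)
  let ?d = "\<lambda>j. vertex_degree (induced_edges E (set (drop j vs))) (vs ! j)"
  have "vs ! i \<in> V"
    using vs i by auto
  then obtain U where U: "U \<subseteq> V" "vs ! i \<in> U"
    "\<And>u. u \<in> U \<Longrightarrow> core_number V E (vs ! i) \<le> vertex_degree (induced_edges E U) u"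
    using core_number_attained by blast
  have "U \<subseteq> set vs" "U \<noteq> {}"
    using U vs by auto
  then obtain j where "j < length vs" and j: "vs ! j \<in> U" "U \<subseteq> set (drop j vs)"
    "\<And>l. l < length vs \<Longrightarrow> vs ! l \<in> U \<Longrightarrow> j \<le> l"
    by (rule first_index_in_subset) blast
  have "core_number V E (vs ! i) \<le> vertex_degree (induced_edges E U) (vs ! j)"
    using U(3) j(1) by blast
  \<comment> \<open>All of \<open>U\<close> lies in the suffix starting at \<open>j\<close>, and
    enlarging the vertex set cannot lower a degree.\<close>
  also have "\<dots> \<le> ?d j"
    using induced_degree_mono[OF j(2)] vs set_drop_subset[of j vs] by blast
  \<comment> \<open>Here \<open>j \<le> i\<close>, because \<open>vs ! i\<close> is itself in
    \<open>U\<close> and \<open>j\<close> is the first position in \<open>U\<close>.\<close>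
  also have "\<dots> \<le> Max (?d ` {..i})"
    using j(3)[OF i U(2)] by (intro Max_ge) auto
  finally show "core_number V E (vs ! i) \<le> Max (?d ` {..i})" .
  have "?d j \<le> core_number V E (vs ! i)" if "j \<le> i" for j
  proof (rule core_number_ge)
    show "set (drop j vs) \<subseteq> V"
      using vs set_drop_subset[of j vs] by blast
    show "vs ! i \<in> set (drop j vs)"
      using nth_mem_set_drop that i by blast
    show "?d j \<le> vertex_degree (induced_edges E (set (drop j vs))) u" if "u \<in> set (drop j vs)" for u
      using min \<open>j \<le> i\<close> i that by simp
  qed
  then show "Max (?d ` {..i}) \<le> core_number V E (vs ! i)"
    by simp
qed

lemma degeneracy_ordering_exists: "\<exists>vs. degeneracy_ordering V E vs"
proof -
  obtain vs where vs: "distinct vs" "set vs = V"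
    and min: "\<And>i u. i < length vs \<Longrightarrow> u \<in> set (drop i vs) \<Longrightarrow>
      vertex_degree (induced_edges E (set (drop i vs))) (vs ! i)
        \<le> vertex_degree (induced_edges E (set (drop i vs))) u"
    using min_degree_peeling_exists[of V] by auto
  let ?d = "\<lambda>j. vertex_degree (induced_edges E (set (drop j vs))) (vs ! j)"
  have "core_number V E (vs ! i) \<le> core_number V E (vs ! j)" if "i \<le> j" "j < length vs" for i j
  proof -
    have "Max (?d ` {..i}) \<le> Max (?d ` {..j})"
      using that by (intro Max_mono) auto
    then show ?thesis
      using core_number_min_degree_peeling[OF vs(2) min] that by simp
  qed
  then have "sorted (map (core_number V E) vs)"
    by (simp add: sorted_iff_nth_mono)
  \<comment> \<open>Both values are maxima over the same earlier removal degrees together with the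
    vertex's own remaining degree, so the comparison of remaining degrees carries over. For
    \<open>i = 0\<close> there are no earlier removals.\<close>
  moreover have "current_core_value E vs i (vs ! i) \<le> current_core_value E vs i u"
    if "i < length vs" "u \<in> set (drop i vs)" for i u
    unfolding current_core_value_def using min[OF that]
    by (cases "i = 0") (auto simp: lessThan_empty_iff intro: max.mono)
  ultimately show ?thesis
    unfolding degeneracy_ordering_def using vs by blast
qed

section \<open>Size of the subproblems\<close>

lemma removal_degree_le_graph_core_number:
  assumes "degeneracy_ordering V E vs" "i < length vs"
  shows "vertex_degree (induced_edges E (set (drop i vs))) (vs ! i) \<le> graph_core_number V E"
  using assms(2)
proof (induction i rule: less_induct)
  case (less i)
  let ?d = "\<lambda>j. vertex_degree (induced_edges E (set (drop j vs))) (vs ! j)"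
  have vs: "set vs = V"
    using assms(1) by (simp add: degeneracy_ordering_def)
  show ?case
  \<comment> \<open>A degeneracy ordering minimises the current core value, which can hide the
    remaining degree behind an earlier removal degree. If one of those is at least
    \<open>?d i\<close>, the induction hypothesis already bounds \<open>?d i\<close>.\<close>
  proof (cases "\<exists>j<i. ?d i \<le> ?d j")
    case True
    then show ?thesis
      using less by (meson le_trans less_trans)
  next
    case False
    have "?d i \<le> vertex_degree (induced_edges E (set (drop i vs))) u"
      if "u \<in> set (drop i vs)" for u
    proof -
      have "?d i \<le> current_core_value E vs i (vs ! i)"
        unfolding current_core_value_def by (rule Max_ge) auto
      also have "\<dots> \<le> current_core_value E vs i u"
        using assms(1) less.prems that by (simp add: degeneracy_ordering_def)
      finally have "?d i \<le> current_core_value E vs i u" .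
      \<comment> \<open>Every earlier removal degree is now smaller than \<open>?d i\<close>, so in
        the maximum for \<open>u\<close> only the remaining degree of \<open>u\<close> can reach
        \<open>?d i\<close>.\<close>
      then show ?thesis
        unfolding current_core_value_def using False by (subst (asm) Max_ge_iff) auto
    qed
    then have "?d i \<le> core_number V E (vs ! i)"
      using vs less.prems set_drop_subset[of i vs]
      by (intro core_number_ge[of "set (drop i vs)"] nth_mem_set_drop) auto
    also have "\<dots> \<le> graph_core_number V E"
      using graph_core_number_ge vs less.prems by auto
    finally show ?thesis .
  qed
qed

text \<open>Turns the bound on removal degrees into a bound on rooted subproblems. The suffix at
  \<open>i\<close> also contains the root, which is not its own neighbour.\<close>

lemma card_later_neighbours:
  assumes "i < length vs"
  shows "card (later_neighbours E vs i)
    = vertex_degree (induced_edges E (set (drop i vs))) (vs ! i)"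
proof -
  have "set (drop i vs) = insert (vs ! i) (set (drop (Suc i) vs))"
    using assms by (metis Cons_nth_drop_Suc list.simps(15))
  then have "later_neighbours E vs i = {u. {u, vs ! i} \<in> induced_edges E (set (drop i vs))}"
    using no_loop by (auto simp: later_neighbours_def induced_edges_def)
  then show ?thesis
    by (simp add: vertex_degree_def)
qed

lemma card_subproblem_le:
  assumes "degeneracy_ordering V E vs" "(r, S) \<in> subproblems V E vs"
  shows "card S \<le> graph_core_number V E"
proof -
  have len: "length vs = card V"
    using assms(1) by (metis degeneracy_ordering_def distinct_card)
  consider "S = set (drop (card V - graph_core_number V E) vs)"
    | i where "i < card V - graph_core_number V E" "S = later_neighbours E vs i"
    using assms(2) by (auto simp: subproblems_def)
  then show ?thesis
  proof cases
    case 1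
    then show ?thesis
      using card_length[of "drop (card V - graph_core_number V E) vs"] len by simp
  next
    case 2
    then show ?thesis
      using removal_degree_le_graph_core_number[OF assms(1), of i] card_later_neighbours[of i vs] len
      by simp
  qed
qed

section \<open>Correctness of the decomposition\<close>

lemma subproblems_decompose:
  assumes vs: "set vs = V" "distinct vs"
  shows "decomposes_maximum_clique V E (subproblems V E vs)"
proof -
  let ?P = "subproblems V E vs" and ?m = "card V - graph_core_number V E"
  have len: "length vs = card V"
    using vs by (metis distinct_card)
  have last: "(None, set (drop ?m vs)) \<in> ?P"
    by (simp add: subproblems_def)
  have rooted: "(Some (vs ! i), later_neighbours E vs i) \<in> ?P" if "i < ?m" for i
    using that by (auto simp: subproblems_def)
  have cases: "(r = None \<and> S = set (drop ?m vs)) \<or>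
      (\<exists>i<?m. r = Some (vs ! i) \<and> S = later_neighbours E vs i)" if "(r, S) \<in> ?P" for r S
    using that by (auto simp: subproblems_def)
  have later: "later_neighbours E vs i \<subseteq> V" for i
    using edge_in_vertices by (auto simp: later_neighbours_def)
  have inside: "set_option r \<subseteq> V \<and> S \<subseteq> V" if "(r, S) \<in> ?P" for r S
    using cases[OF that] later vs(1) len set_drop_subset[of ?m vs] by auto
  have largest: "maximum_clique V E C"
    if sol: "\<forall>(r, S) \<in> ?P. maximum_clique S (induced_edges E S) (sol (r, S))"
      and C: "C \<in> (\<lambda>(r, S). set_option r \<union> sol (r, S)) ` ?P"
      and max: "\<forall>D \<in> (\<lambda>(r, S). set_option r \<union> sol (r, S)) ` ?P. card D \<le> card C" for sol C
  proof -
    \<comment> \<open>For subsets of \<open>S\<close>, being a clique in the induced graph and in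
      the whole graph agree, so the solutions can be compared using \<open>E\<close> alone.\<close>
    have sub: "sol (r, S) \<subseteq> S" and clique_sol: "clique (sol (r, S)) E"
      and best: "\<And>D. D \<subseteq> S \<Longrightarrow> clique D E \<Longrightarrow> card D \<le> card (sol (r, S))"
      if "(r, S) \<in> ?P" for r S
      using sol that by (auto simp: maximum_clique_def clique_induced_edges_iff)
    from C obtain r S where rS: "(r, S) \<in> ?P" "C = set_option r \<union> sol (r, S)"
      by auto
    have "C \<subseteq> V"
      using rS inside sub by blast
    moreover have "clique C E"
      using cases[OF rS(1)]
    proof (elim disjE exE conjE)
      assume "r = None"
      then show ?thesis
        using rS clique_sol by simp
    next
      fix i assume i: "r = Some (vs ! i)" "S = later_neighbours E vs i"
      have "clique (insert (vs ! i) (sol (r, S))) E"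
        using clique_sol[OF rS(1)] sub[OF rS(1)]
        by (intro clique_insert_root) (auto simp: i later_neighbours_def)
      then show ?thesis
        using rS(2) i(1) by simp
    qed
    moreover have "card D \<le> card C" if D: "D \<subseteq> V" "clique D E" for D
    proof (cases "D \<subseteq> set (drop ?m vs)")
      case True
      then show ?thesis
        using best[OF last _ D(2)] max last by fastforce
    next
      case False
      then have "D \<subseteq> set vs" "D \<noteq> {}"
        using D(1) vs(1) by auto
      then obtain i where i: "i < length vs" "vs ! i \<in> D" "D \<subseteq> set (drop i vs)"
        by (rule first_index_in_subset)
      \<comment> \<open>Otherwise the suffix at \<open>i\<close>, and with it \<open>D\<close>,
        would lie among the last vertices.\<close>
      have "i < ?m"
        using False i(3) set_drop_subset_set_drop[of ?m i vs] by (meson leI order_trans)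
      note root = rooted[OF this]
      let ?S = "later_neighbours E vs i"
      let ?A = "sol (Some (vs ! i), ?S)"
      have "set (drop i vs) = insert (vs ! i) (set (drop (Suc i) vs))"
        using i(1) by (metis Cons_nth_drop_Suc list.simps(15))
      then have "D - {vs ! i} \<subseteq> ?S"
        using i D(2) by (auto simp: later_neighbours_def clique_def)
      moreover have "clique (D - {vs ! i}) E"
        using D(2) by (auto simp: clique_def)
      ultimately have "card (D - {vs ! i}) \<le> card ?A"
        by (rule best[OF root])
      \<comment> \<open>Hence adding the root to \<open>?A\<close> raises its size by exactly one,
        which makes up for the root taken out of \<open>D\<close>.\<close>
      moreover have "finite ?A" "vs ! i \<notin> ?A"
        using sub[OF root] later[of i] finite_vertices no_loop
        by (auto simp: later_neighbours_def intro: finite_subset[of _ V])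
      ultimately have "card D \<le> card (insert (vs ! i) ?A)"
        using i(2) by (simp add: card_Diff_singleton)
      also have "\<dots> \<le> card C"
        using max root by fastforce
      finally show ?thesis .
    qed
    ultimately show ?thesis
      by (simp add: maximum_clique_def)
  qed
  show ?thesis
    unfolding decomposes_maximum_clique_def Let_def
  proof (intro conjI allI impI ballI)
    show "?P \<noteq> {}"
      using last by blast
    show "case x of (r, S) \<Rightarrow> set_option r \<subseteq> V \<and> S \<subseteq> V" if "x \<in> ?P" for x
      using inside that by (cases x) simp
  qed (rule finite_subproblems, rule largest)
qed

end

theorem proposition1:
  fixes V :: "'a set" and E :: "'a set set"
  assumes "simple_graph V E"
  shows "(\<exists>vs. degeneracy_ordering V E vs) \<and>
    (\<forall>vs. degeneracy_ordering V E vs \<longrightarrow>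
       decomposes_maximum_clique V E (subproblems V E vs) \<and>
       int (card (subproblems V E vs)) \<le> int (card V) - int (graph_core_number V E) + 1 \<and>
       (\<forall>(r, S) \<in> subproblems V E vs. card S \<le> graph_core_number V E))"
proof (intro conjI allI impI)
  show "\<exists>vs. degeneracy_ordering V E vs"
    by (rule degeneracy_ordering_exists[OF assms])
next
  fix vs assume vs: "degeneracy_ordering V E vs"
  then show "decomposes_maximum_clique V E (subproblems V E vs)"
    by (intro subproblems_decompose[OF assms]) (auto simp: degeneracy_ordering_def)
  show "int (card (subproblems V E vs)) \<le> int (card V) - int (graph_core_number V E) + 1"
    \<comment> \<open>The strict inequality makes the subtraction of natural numbers in
      \<open>card_subproblems\<close> exact, so it agrees with the integer difference.\<close>
    using card_subproblems[of V E vs] graph_core_number_less_card[OF assms] by linarith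
  show "\<forall>(r, S) \<in> subproblems V E vs. card S \<le> graph_core_number V E"
    using card_subproblem_le[OF assms vs] by blast
qed

end
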